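(* Let $(\alpha,\beta)\in[0,1]^2$ be a pair of elements of a quadratic number field $K$ such that $\alpha$ and $\beta$ are both irrational or both rational. Then there exist a finite set $\mathcal{T}=\mathcal{T}_{00}\cup\mathcal{T}_{01}\cup\mathcal{T}_{10}\cup\mathcal{T}_{11}$ of Wang tiles with vertical and horizontal stripes and four non-collinear points $A,B,C,D\in\mathbb{Z}^2$ such that: (i) $(x,y)=(\alpha,\beta)$ is a solution of the equation $$\begin{pmatrix}0\\0\end{pmatrix}=(1-x)\big((1-y)A+yB\big)+x\big((1-y)C+yD\big);\qquad( * )$$ (ii) $\mathcal{T}$ determines the quadrilateral $ABDC$, and the opposite sides of $ABDC$ are not parallel (i.e. $AB$ and $CD$ are not parallel, and $AC$ and $BD$ are not parallel); (iii) $\mathcal{T}$ admits a valid tiling $w:\mathbb{Z}^2\to\mathcal{T}$ in which vertical stripes (tiles in $\mathcal{T}_{01}\cup\mathcal{T}_{11}$) have density $\alpha$ and horizontal stripes (tiles in $\mathcal{T}_{10}\cup\mathcal{T}_{11}$) have density $\beta$; (iv) in every valid tiling by $\mathcal{T}$, the density $x$ of vertical stripes and the density $y$ of horizontal stripes exist, and $(x,y)$ is a solution of $( * )$. In particular, if $\alpha$ and $\beta$ are irrational, then the tile set $\mathcal{T}$ is aperiodic.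
   Context: Wang tiles. Let $I$ (vertical colors) and $J$ (horizontal colors) be finite sets. A Wang tile is a tuple $\tau=(a,b,c,d)\in I\times J\times I\times J$, where $a,b,c,d$ are the labels of the right (east), top (north), left (west) and bottom (south) edges of a unit square. For a finite set $\mathcal{T}$ of Wang tiles, a configuration (tiling) $w:\mathbb{Z}^2\to\mathcal{T}$ is valid if for all $n\in\mathbb{Z}^2$ the east label of $w_n$ equals the west label of $w_{n+(1,0)}$ and the north label of $w_n$ equals the south label of $w_{n+(0,1)}$. It is periodic if there is $p\in\mathbb{Z}^2\setminus\{0\}$ with $w_{n+p}=w_n$ for all $n$. $\mathcal{T}$ is aperiodic if it admits at least one valid configuration and no valid configuration is periodic. Stripes. $\mathcal{T}$ has horizontal and vertical stripes if there are partitions $I=I_0\sqcup I_1$ and $J=J_0\sqcup J_1$ such that every $(a,b,c,d)\in\mathcal{T}$ has $a,c$ in the same part of $I$ and $b,d$ in the same part of $J$. Then $\mathcal{T}_{xy}=\mathcal{T}\cap(I_x\times J_y\times I_x\times J_y)$ for $x,y\in\{0,1\}$ ($x=1$: horizontal stripe present; $y=1$: vertical stripe present). Quadrilateral. $\mathcal{T}$ determines the quadrilateral $ABDC$ ($A,B,C,D\in\mathbb{R}^2$) if there are maps $v:I\to\mathbb{R}^2$ and $h:J\to\mathbb{R}^2$ such that for every $\tau=(a,b,c,d)\in\mathcal{T}$, the vector $v(a)+h(b)-v(c)-h(d)$ equals $A$ if $\tau\in\mathcal{T}_{00}$, $B$ if $\tau\in\mathcal{T}_{10}$, $C$ if $\tau\in\mathcal{T}_{01}$,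 and $D$ if $\tau\in\mathcal{T}_{11}$. Conventions. Points are non-collinear if they do not all lie on one line. Two vectors are parallel if their span is at most one-dimensional (so the zero vector is parallel to every vector). The density of a subset $\mathcal{S}\subset\mathcal{T}$ in $w$ is $\lim_{K\to\infty}\#\{n\in\mathbb{Z}^2\cap[-K,K]^2: w_n\in\mathcal{S}\}/(2K+1)^2$, when the limit exists. A quadratic number field is $\mathbb{Q}(\sqrt d)$ for a square-free integer $d\neq 0,1$. *)

theory Defs
  imports "HOL-Analysis.Analysis" "HOL-Computational_Algebra.Squarefree"
begin

text \<open>A tile is a tuple (right, top, left, bottom) of edge labels; the right and left labels
  are vertical colors, the top and bottom labels are horizontal colors.\<close>

type_synonym ('i, 'j) tile = "'i \<times> 'j \<times> 'i \<times> 'j"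

fun east :: "('i, 'j) tile \<Rightarrow> 'i" where "east (a, b, c, d) = a"
fun north :: "('i, 'j) tile \<Rightarrow> 'j" where "north (a, b, c, d) = b"
fun west :: "('i, 'j) tile \<Rightarrow> 'i" where "west (a, b, c, d) = c"
fun south :: "('i, 'j) tile \<Rightarrow> 'j" where "south (a, b, c, d) = d"

definition wang_tile_set :: "'i set \<Rightarrow> 'j set \<Rightarrow> ('i, 'j) tile set \<Rightarrow> bool" where
  "wang_tile_set I J T \<longleftrightarrow> finite I \<and> finite J \<and> T \<subseteq> I \<times> J \<times> I \<times> J"

definition valid_tiling :: "('i, 'j) tile set \<Rightarrow> (int \<times> int \<Rightarrow> ('i, 'j) tile) \<Rightarrow> bool" where
  "valid_tiling T w \<longleftrightarrow>
     (\<forall>n. w n \<in> T) \<and>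
     (\<forall>n. east (w n) = west (w (n + (1, 0)))) \<and>
     (\<forall>n. north (w n) = south (w (n + (0, 1))))"

definition periodic_tiling :: "(int \<times> int \<Rightarrow> 'a) \<Rightarrow> bool" where
  "periodic_tiling w \<longleftrightarrow> (\<exists>p. p \<noteq> (0, 0) \<and> (\<forall>n. w (n + p) = w n))"

definition aperiodic_tile_set :: "('i, 'j) tile set \<Rightarrow> bool" where
  "aperiodic_tile_set T \<longleftrightarrow>
     (\<exists>w. valid_tiling T w) \<and> (\<forall>w. valid_tiling T w \<longrightarrow> \<not> periodic_tiling w)"

definition has_density :: "(int \<times> int \<Rightarrow> 'a) \<Rightarrow> 'a set \<Rightarrow> real \<Rightarrow> bool" where
  "has_density w S \<delta> \<longleftrightarrow>
     (\<lambda>K::nat. real (card {n \<in> {- int K..int K} \<times> {- int K..int K}. w n \<in> S})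
        / (2 * real K + 1)\<^sup>2) \<longlonglongrightarrow> \<delta>"

definition partition2 :: "'a set \<Rightarrow> 'a set \<Rightarrow> 'a set \<Rightarrow> bool" where
  "partition2 X X0 X1 \<longleftrightarrow> X = X0 \<union> X1 \<and> X0 \<inter> X1 = {}"

definition has_stripes ::
  "'i set \<Rightarrow> 'j set \<Rightarrow> 'i set \<Rightarrow> 'i set \<Rightarrow> 'j set \<Rightarrow> 'j set \<Rightarrow> ('i, 'j) tile set \<Rightarrow> bool" where
  "has_stripes I J I0 I1 J0 J1 T \<longleftrightarrow>
     partition2 I I0 I1 \<and> partition2 J J0 J1 \<and>
     (\<forall>(a, b, c, d) \<in> T.
        (a \<in> I0 \<and> c \<in> I0 \<or> a \<in> I1 \<and> c \<in> I1) \<and>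
        (b \<in> J0 \<and> d \<in> J0 \<or> b \<in> J1 \<and> d \<in> J1))"

text \<open>For parts \<open>X\<close> and \<open>Y\<close> with indices \<open>x\<close> and \<open>y\<close>, \<open>tile_part T X Y\<close> is the class
  \<open>T\<^sub>x\<^sub>y\<close>; a horizontal stripe is present iff \<open>x = 1\<close>, a vertical stripe iff \<open>y = 1\<close>.\<close>

definition tile_part :: "('i, 'j) tile set \<Rightarrow> 'i set \<Rightarrow> 'j set \<Rightarrow> ('i, 'j) tile set" where
  "tile_part T X Y = T \<inter> (X \<times> Y \<times> X \<times> Y)"

definition vertical_stripe_tiles ::
  "'i set \<Rightarrow> 'i set \<Rightarrow> 'j set \<Rightarrow> 'j set \<Rightarrow> ('i, 'j) tile set \<Rightarrow> ('i, 'j) tile set" where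
  "vertical_stripe_tiles I0 I1 J0 J1 T = tile_part T I0 J1 \<union> tile_part T I1 J1"

definition horizontal_stripe_tiles ::
  "'i set \<Rightarrow> 'i set \<Rightarrow> 'j set \<Rightarrow> 'j set \<Rightarrow> ('i, 'j) tile set \<Rightarrow> ('i, 'j) tile set" where
  "horizontal_stripe_tiles I0 I1 J0 J1 T = tile_part T I1 J0 \<union> tile_part T I1 J1"

definition determines_quadrilateral ::
  "'i set \<Rightarrow> 'i set \<Rightarrow> 'j set \<Rightarrow> 'j set \<Rightarrow> ('i, 'j) tile set \<Rightarrow>
   real \<times> real \<Rightarrow> real \<times> real \<Rightarrow> real \<times> real \<Rightarrow> real \<times> real \<Rightarrow> bool" where
  "determines_quadrilateral I0 I1 J0 J1 T A B C D \<longleftrightarrow>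
     (\<exists>(v :: 'i \<Rightarrow> real \<times> real) (h :: 'j \<Rightarrow> real \<times> real).
        (\<forall>(a, b, c, d) \<in> tile_part T I0 J0. v a + h b - v c - h d = A) \<and>
        (\<forall>(a, b, c, d) \<in> tile_part T I1 J0. v a + h b - v c - h d = B) \<and>
        (\<forall>(a, b, c, d) \<in> tile_part T I0 J1. v a + h b - v c - h d = C) \<and>
        (\<forall>(a, b, c, d) \<in> tile_part T I1 J1. v a + h b - v c - h d = D))"

definition parallel :: "real \<times> real \<Rightarrow> real \<times> real \<Rightarrow> bool" where
  "parallel u v \<longleftrightarrow> dim (span {u, v}) \<le> 1"

definition stripe_equation ::
  "real \<times> real \<Rightarrow> real \<times> real \<Rightarrow> real \<times> real \<Rightarrow> real \<times> real \<Rightarrow> real \<Rightarrow> real \<Rightarrow> bool" where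
  "stripe_equation A B C D x y \<longleftrightarrow>
     (0, 0) = (1 - x) *\<^sub>R ((1 - y) *\<^sub>R A + y *\<^sub>R B) + x *\<^sub>R ((1 - y) *\<^sub>R C + y *\<^sub>R D)"

text \<open>The field \<open>\<rat>(\<surd>d)\<close> is taken inside the complex numbers, so that imaginary quadratic
  fields are covered as well.\<close>

definition quadratic_number_field :: "complex set \<Rightarrow> bool" where
  "quadratic_number_field K \<longleftrightarrow>
     (\<exists>d::int. squarefree d \<and> d \<noteq> 0 \<and> d \<noteq> 1 \<and>
        K = {of_rat p + of_rat q * csqrt (of_int d) | p q. True})"

end

theory Submission
  imports Defs
begin

text \<open>Since \<open>\<alpha>\<close>, if irrational, generates \<open>K\<close>, the numbers \<open>1, \<alpha>, \<beta>, \<alpha>\<beta>\<close> satisfy two integer relations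
  \<open>R + U\<alpha> - k\<beta> = 0\<close> and \<open>k\<alpha>\<beta> - P\<alpha> - Q = 0\<close> with \<open>U, k \<noteq> 0\<close>; they say that the bilinear map
  \<open>\<Phi>(x, y) = (R + Ux - ky, kxy - Px - Q)\<close> vanishes at \<open>(\<alpha>, \<beta>)\<close>, and the corners of the quadrilateral
  are its values on \<open>{0, 1}\<^sup>2\<close>. A color is a stripe bit together with a bounded vector in
  \<open>\<int>\<^sup>2\<close>, and a tile is admitted iff its stripe bits match and the divergence of its vectors is the
  corner that belongs to its bits. Summing the divergence over a large box leaves only a boundary
  term, so the stripe frequencies in growing boxes tend to the zero set of \<open>\<Phi>\<close>; this set is finite
  and the frequencies change by vanishing steps, hence they converge. A periodic tiling would have
  a rational frequency, whereas all zeros of \<open>\<Phi>\<close> are irrational if \<open>\<alpha>\<close> is. Conversely, for Sturmian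
  stripes of slopes \<open>\<alpha>\<close> and \<open>\<beta>\<close> the right-hand side of the divergence equation is a bounded real
  coboundary, which can be rounded to a bounded integer one.\<close>

section \<open>Rational and integer relations in a quadratic field\<close>

lemma common_denominator:
  assumes "finite S" "S \<subseteq> (\<rat> :: real set)"
  shows "\<exists>k::int. k > 0 \<and> (\<forall>x\<in>S. of_int k * x \<in> \<int>)"
  using assms
proof (induction S rule: finite_induct)
  case empty
  show ?case by (intro exI[of _ 1]) auto
next
  case (insert y S)
  then obtain k :: int where k: "k > 0" "\<forall>x\<in>S. of_int k * x \<in> \<int>" by auto
  from insert.prems obtain a b :: int where ab: "b > 0" "y = of_int a / of_int b"
    by (auto elim: Rats_cases')
  have "real_of_int (k * b) * y = of_int (k * a)" using ab by simp
  then have "real_of_int (k * b) * y \<in> \<int>" by (metis Ints_of_int)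
  moreover have "real_of_int (k * b) * x \<in> \<int>" if "x \<in> S" for x
  proof -
    have "real_of_int (k * b) * x = of_int b * (of_int k * x)" by simp
    then show ?thesis using k(2) that by (metis Ints_mult Ints_of_int)
  qed
  ultimately show ?case using k(1) ab(1) by (intro exI[of _ "k * b"]) auto
qed

lemma complex_of_real_of_rat: "complex_of_real (of_rat q) = of_rat q"
proof -
  obtain a b :: int where "b > 0" "q = Fract a b" by (cases q) auto
  then show ?thesis by (simp add: of_rat_rat)
qed

text \<open>If \<alpha> is irrational, then 1 and \<alpha> form a basis of \<open>K\<close> over the
  rationals, and the relations list the coordinates of \<beta> and of \<alpha>\<beta> in it;
  \<open>t\<close> is nonzero because \<beta> is irrational as well.\<close>

lemma quadratic_field_relations:
  fixes \<alpha> \<beta> :: real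
  assumes K: "quadratic_number_field K" "complex_of_real \<alpha> \<in> K" "complex_of_real \<beta> \<in> K"
    and rat: "(\<alpha> \<notin> \<rat> \<and> \<beta> \<notin> \<rat>) \<or> (\<alpha> \<in> \<rat> \<and> \<beta> \<in> \<rat>)"
  obtains r t p q :: real where "r \<in> \<rat>" "t \<in> \<rat>" "p \<in> \<rat>" "q \<in> \<rat>" "t \<noteq> 0"
    "\<beta> = r + t * \<alpha>" "\<alpha> * \<beta> = p * \<alpha> + q"
proof (cases "\<alpha> \<in> \<rat>")
  case True
  \<comment> \<open>For rational numbers trivial relations suffice; the choice 1 keeps
    \<open>t\<close> nonzero.\<close>
  then show ?thesis using rat by (intro that[of "\<beta> - \<alpha>" 1 0 "\<alpha> * \<beta>"]) auto
next
  case False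
  obtain d :: int where d: "K = {of_rat p + of_rat q * csqrt (of_int d) | p q. True}"
    using K(1) unfolding quadratic_number_field_def by blast
  define \<delta> where "\<delta> = csqrt (of_int d)"
  obtain a b where ab: "complex_of_real \<alpha> = of_rat a + of_rat b * \<delta>" using K(2) d \<delta>_def by auto
  obtain a' b' where ab': "complex_of_real \<beta> = of_rat a' + of_rat b' * \<delta>" using K(3) d \<delta>_def by auto
  have \<delta>2: "\<delta> * \<delta> = of_rat (of_int d)" unfolding \<delta>_def
    by (metis of_rat_of_int_eq power2_csqrt power2_eq_square)
  have "b \<noteq> 0"
  proof
    assume "b = 0"
    then have "complex_of_real \<alpha> = complex_of_real (of_rat a)"
      using ab by (simp add: complex_of_real_of_rat)
    then have "\<alpha> = of_rat a" by (simp only: of_real_eq_iff)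
    then show False using False by simp
  qed
  have "b' \<noteq> 0"
  proof
    assume "b' = 0"
    then have "complex_of_real \<beta> = complex_of_real (of_rat a')"
      using ab' by (simp add: complex_of_real_of_rat)
    then have "\<beta> = of_rat a'" by (simp only: of_real_eq_iff)
    then show False using False rat by simp
  qed
  \<comment> \<open>\<open>t\<close> and \<open>p\<close> come from comparing the coefficients of
    \<delta>, \<open>r\<close> and \<open>q\<close> from comparing the rational parts.\<close>
  define t where "t = b' / b"
  define r where "r = a' - t * a"
  define p where "p = (a * b' + a' * b) / b"
  define q where "q = a * a' + b * b' * of_int d - p * a"
  have c1: "(of_rat b' :: complex) = of_rat t * of_rat b" and 
    c2: "(of_rat a' :: complex) = of_rat r + of_rat t * of_rat a"
    using \<open>b \<noteq> 0\<close> by (simp_all add: t_def r_def of_rat_diff flip: of_rat_mult)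
  have "p * b = a * b' + a' * b" "a * a' + b * b' * of_int d = q + p * a"
    using \<open>b \<noteq> 0\<close> by (simp_all add: p_def q_def)
  then have c3: "of_rat p * of_rat b = (of_rat a * of_rat b' + of_rat a' * of_rat b :: complex)" and
    c4: "of_rat a * of_rat a' + of_rat b * of_rat b' * of_rat (of_int d)
      = (of_rat q + of_rat p * of_rat a :: complex)"
    by (metis of_rat_add of_rat_mult)+
  \<comment> \<open>The identities are checked in the complex numbers, where \<delta> squares to
    \<open>d\<close> whatever the sign of \<open>d\<close>, and then pulled back along the injective
    embedding of the reals.\<close>
  have "complex_of_real \<beta> = complex_of_real (of_rat r + of_rat t * \<alpha>)"
    unfolding of_real_add of_real_mult complex_of_real_of_rat ab ab' c1 c2 by (simp add: algebra_simps)
  then have 1: "\<beta> = of_rat r + of_rat t * \<alpha>" by (simp only: of_real_eq_iff)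
  have "complex_of_real (\<alpha> * \<beta>) = (of_rat a * of_rat a' + of_rat b * of_rat b' * (\<delta> * \<delta>))
      + (of_rat a * of_rat b' + of_rat a' * of_rat b) * \<delta>"
    unfolding of_real_mult ab ab' by (simp add: algebra_simps)
  also have "\<dots> = complex_of_real (of_rat p * \<alpha> + of_rat q)"
    unfolding of_real_add of_real_mult complex_of_real_of_rat ab \<delta>2 c4 c3[symmetric]
    by (simp add: algebra_simps)
  finally have "\<alpha> * \<beta> = of_rat p * \<alpha> + of_rat q" by (simp only: of_real_eq_iff)
  then show ?thesis using 1 \<open>b \<noteq> 0\<close> \<open>b' \<noteq> 0\<close>
    by (intro that[of "of_rat r" "of_rat t" "of_rat p" "of_rat q"]) (auto simp: t_def)
qed

text \<open>One common denominator \<open>k\<close> clears both relations. As \<beta> and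
  \<alpha>\<beta> get the same coefficient up to sign, \<alpha> times the first relation plus the
  second is a quadratic equation in \<alpha> alone.\<close>

lemma quadratic_field_integer_relations:
  fixes \<alpha> \<beta> :: real
  assumes "quadratic_number_field K" "complex_of_real \<alpha> \<in> K" "complex_of_real \<beta> \<in> K"
    and "(\<alpha> \<notin> \<rat> \<and> \<beta> \<notin> \<rat>) \<or> (\<alpha> \<in> \<rat> \<and> \<beta> \<in> \<rat>)"
  obtains R U k P Q :: int where "k \<noteq> 0" "U \<noteq> 0"
    "of_int R + of_int U * \<alpha> - of_int k * \<beta> = 0"
    "of_int k * (\<alpha> * \<beta>) - of_int P * \<alpha> - of_int Q = 0"
proof -
  obtain r t p q :: real where rat: "r \<in> \<rat>" "t \<in> \<rat>" "p \<in> \<rat>" "q \<in> \<rat>" "t \<noteq> 0"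
    and eq: "\<beta> = r + t * \<alpha>" "\<alpha> * \<beta> = p * \<alpha> + q"
    using quadratic_field_relations[OF assms] by metis
  obtain k :: int where k: "k > 0" "\<forall>x\<in>{r, t, p, q}. of_int k * x \<in> \<int>"
    using common_denominator[of "{r, t, p, q}"] rat by auto
  obtain R where R: "of_int k * r = of_int R" using k(2) by (auto elim: Ints_cases)
  obtain U where U: "of_int k * t = of_int U" using k(2) by (auto elim: Ints_cases)
  obtain P where P: "of_int k * p = of_int P" using k(2) by (auto elim: Ints_cases)
  obtain Q where Q: "of_int k * q = of_int Q" using k(2) by (auto elim: Ints_cases)
  show ?thesis
  proof
    show "k \<noteq> 0" using k(1) by simp
    show "U \<noteq> 0" using U k(1) rat(5) by auto
    show "of_int R + of_int U * \<alpha> - of_int k * \<beta> = 0"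
      unfolding R[symmetric] U[symmetric] by (subst eq(1)) (simp add: algebra_simps)
    show "of_int k * (\<alpha> * \<beta>) - of_int P * \<alpha> - of_int Q = 0"
      unfolding P[symmetric] Q[symmetric] by (subst eq(2)) (simp add: algebra_simps)
  qed
qed

section \<open>Sequences with vanishing steps and means of stripe patterns\<close>

text \<open>After completing the square, the distance of \<open>x n\<close> from the vertex of the
  parabola has a limit. If it is positive, vanishing steps cannot carry \<open>x\<close> across the
  vertex, so the sequence settles at one root.\<close>

lemma quadratic_null_sequence_convergent:
  fixes x :: "nat \<Rightarrow> real"
  assumes lim: "(\<lambda>n. a * (x n)\<^sup>2 + b * x n + c) \<longlonglongrightarrow> 0" and "a \<noteq> 0"
    and step: "(\<lambda>n. x (Suc n) - x n) \<longlonglongrightarrow> 0"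
  shows "convergent x"
proof -
  define y where "y n = x n + b / (2 * a)" for n
  define \<delta> where "\<delta> = (b\<^sup>2 - 4 * a * c) / (4 * a\<^sup>2)"
  have "(\<lambda>n. (a * (x n)\<^sup>2 + b * x n + c) / a + \<delta>) \<longlonglongrightarrow> 0 / a + \<delta>"
    using \<open>a \<noteq> 0\<close> by (intro tendsto_intros lim)
  moreover have "(a * (x n)\<^sup>2 + b * x n + c) / a + \<delta> = (y n)\<^sup>2" for n
    using \<open>a \<noteq> 0\<close> by (simp add: y_def \<delta>_def field_simps power2_eq_square)
  ultimately have "(\<lambda>n. (y n)\<^sup>2) \<longlonglongrightarrow> \<delta>" by simp
  then have "(\<lambda>n. sqrt ((y n)\<^sup>2)) \<longlonglongrightarrow> sqrt \<delta>" by (rule tendsto_real_sqrt)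
  then have abs: "(\<lambda>n. \<bar>y n\<bar>) \<longlonglongrightarrow> sqrt \<delta>" by simp
  define e where "e = sqrt \<delta>"
  \<comment> \<open>\<open>sqrt\<close> is negative on negative arguments, so the sign is read off
    the limit of absolute values.\<close>
  have "e \<ge> 0" using LIMSEQ_le_const[OF abs, of 0] by (simp add: e_def)
  have "convergent y"
  proof (cases "e = 0")
    case True
    then show ?thesis using abs by (auto simp: e_def tendsto_rabs_zero_iff convergent_def)
  next
    case False
    then have "e > 0" using \<open>e \<ge> 0\<close> by simp
    have "(\<lambda>n. y (Suc n) - y n) \<longlonglongrightarrow> 0" using step by (simp add: y_def)
    then have "\<forall>\<^sub>F n in sequentially. \<bar>y (Suc n) - y n\<bar> < e / 2"
      using \<open>e > 0\<close> by (auto dest!: tendstoD[where e = "e / 2"] simp: dist_real_def)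
    moreover have "\<forall>\<^sub>F n in sequentially. \<bar>y n\<bar> > e / 2"
      using abs \<open>e > 0\<close> by (intro order_tendstoD(1)[OF abs]) (simp add: e_def)
    ultimately have "\<forall>\<^sub>F n in sequentially. \<bar>y (Suc n) - y n\<bar> < e / 2 \<and> \<bar>y n\<bar> > e / 2"
      by (rule eventually_conj)
    then obtain N where N: "\<And>n. n \<ge> N \<Longrightarrow> \<bar>y (Suc n) - y n\<bar> < e / 2 \<and> \<bar>y n\<bar> > e / 2"
      by (auto simp: eventually_sequentially)
    \<comment> \<open>Both neighbors exceed \<open>e / 2\<close> in modulus, so a change of sign
      would need a step longer than \<open>e\<close>.\<close>
    have sgn: "sgn (y n) = sgn (y N)" if "n \<ge> N" for n
      using that
    proof (induction n rule: dec_induct)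
      case (step n)
      then show ?case using N[of n] N[of "Suc n"] by (auto simp: sgn_if abs_if split: if_splits)
    qed simp
    have "(\<lambda>n. sgn (y N) * \<bar>y n\<bar>) \<longlonglongrightarrow> sgn (y N) * sqrt \<delta>"
      by (intro tendsto_intros abs)
    moreover have "\<forall>\<^sub>F n in sequentially. sgn (y N) * \<bar>y n\<bar> = y n"
      using eventually_ge_at_top[of N]
      by eventually_elim (metis sgn sgn_mult_abs)
    ultimately have "y \<longlonglongrightarrow> sgn (y N) * sqrt \<delta>" by (rule Lim_transform_eventually)
    then show ?thesis by (auto simp: convergent_def)
  qed
  then have "convergent (\<lambda>n. y n + - (b / (2 * a)))" by (rule convergent_add) (rule convergent_const)
  then show ?thesis by (simp add: y_def)
qed

text \<open>The one-dimensional form of the quotient in \<open>has_density\<close>: for a union of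
  full columns or rows the two agree, see \<open>box_strip_density\<close>.\<close>

definition stripe_mean :: "(int \<Rightarrow> bool) \<Rightarrow> nat \<Rightarrow> real" where
  "stripe_mean s K = (\<Sum>n\<in>{-int K..int K}. of_bool (s n)) / (2 * real K + 1)"

lemma symmetric_interval_sum_Suc:
  fixes f :: "int \<Rightarrow> 'a::comm_monoid_add"
  shows "(\<Sum>n\<in>{-int (Suc K)..int (Suc K)}. f n)
    = (\<Sum>n\<in>{-int K..int K}. f n) + (f (int (Suc K)) + f (- int (Suc K)))"
proof -
  have "{-int (Suc K)..int (Suc K)} = insert (int (Suc K)) (insert (- int (Suc K)) {-int K..int K})"
    by auto
  then show ?thesis by (simp add: ac_simps)
qed

lemma stripe_mean_step: "(\<lambda>K. stripe_mean s (Suc K) - stripe_mean s K) \<longlonglongrightarrow> 0"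
proof (rule Lim_null_comparison)
  have "norm (stripe_mean s (Suc K) - stripe_mean s K) \<le> 2 * inverse (real (Suc K))" for K
  proof -
    define S where "S = (\<Sum>n\<in>{-int K..int K}. of_bool (s n) :: real)"
    define e where "e = (of_bool (s (int (Suc K))) + of_bool (s (- int (Suc K))) :: real)"
    have e: "0 \<le> e" "e \<le> 2" by (auto simp: e_def)
    have "S \<le> (\<Sum>n\<in>{-int K..int K}. 1)" unfolding S_def by (intro sum_mono) auto
    then have S: "0 \<le> S" "S \<le> 2 * real K + 1" by (auto simp: S_def intro!: sum_nonneg)
    have "stripe_mean s (Suc K) - stripe_mean s K = (S + e) / (2 * real K + 3) - S / (2 * real K + 1)"
      unfolding stripe_mean_def symmetric_interval_sum_Suc S_def e_def by (simp add: algebra_simps)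
    also have "\<dots> = (e - 2 * (S / (2 * real K + 1))) / (2 * real K + 3)"
      by (simp add: field_simps)
    finally have eq: "stripe_mean s (Suc K) - stripe_mean s K = \<dots>" .
    \<comment> \<open>The two new bits together and twice the old mean both lie between 0 and 2, so
      the numerator is at most 2 in modulus.\<close>
    have "0 \<le> S / (2 * real K + 1)" "S / (2 * real K + 1) \<le> 1" using S by auto
    then have "\<bar>e - 2 * (S / (2 * real K + 1))\<bar> \<le> 2" using e by linarith
    then have "norm (stripe_mean s (Suc K) - stripe_mean s K) \<le> 2 / (2 * real K + 3)"
      unfolding eq by (simp add: divide_right_mono)
    also have "\<dots> \<le> 2 / real (Suc K)" by (intro divide_left_mono) auto
    finally show ?thesis by (simp add: divide_inverse)
  qed
  then show "\<forall>\<^sub>F K in sequentially. norm (stripe_mean s (Suc K) - stripe_mean s K)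
      \<le> 2 * inverse (real (Suc K))" by simp
  show "(\<lambda>K. 2 * inverse (real (Suc K))) \<longlonglongrightarrow> 0"
    using tendsto_mult_right_zero[OF LIMSEQ_inverse_real_of_nat] by simp
qed

lemma inverse_odd_tendsto_0: "(\<lambda>K. c / (2 * real K + 1)) \<longlonglongrightarrow> 0"
proof (rule Lim_null_comparison)
  show "\<forall>\<^sub>F K in sequentially. norm (c / (2 * real K + 1)) \<le> \<bar>c\<bar> * inverse (real (Suc K))"
    by (auto simp: field_simps mult_left_mono)
  show "(\<lambda>K. \<bar>c\<bar> * inverse (real (Suc K))) \<longlonglongrightarrow> 0"
    using tendsto_mult_right_zero[OF LIMSEQ_inverse_real_of_nat] by simp
qed

lemma sum_telescope_symmetric_interval:
  fixes f :: "int \<Rightarrow> 'a::ab_group_add"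
  shows "(\<Sum>n\<in>{-int K..int K}. f (n + 1) - f n) = f (int K + 1) - f (- int K)"
proof (induction K)
  case (Suc K)
  show ?case unfolding symmetric_interval_sum_Suc Suc by (simp add: algebra_simps)
qed simp

text \<open>Over a window the differences of \<open>f\<close> telescope to two bounded values, which
  vanish after division by the length.\<close>

lemma bounded_coboundary_mean:
  fixes f :: "int \<Rightarrow> real"
  assumes "\<And>n. of_bool (s n) = x + (f (n + 1) - f n)" and "\<And>n. \<bar>f n\<bar> \<le> M"
  shows "stripe_mean s \<longlonglongrightarrow> x"
proof -
  have "stripe_mean s K - x = (f (int K + 1) - f (- int K)) / (2 * real K + 1)" for K
    unfolding stripe_mean_def assms(1) sum.distrib sum_telescope_symmetric_interval
    by (simp add: field_simps)
  then have "norm (stripe_mean s K - x) \<le> 2 * M / (2 * real K + 1)" for K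
    using assms(2)[of "int K + 1"] assms(2)[of "- int K"] by (simp add: divide_right_mono)
  then have "(\<lambda>K. stripe_mean s K - x) \<longlonglongrightarrow> 0"
    by (intro Lim_null_comparison[OF _ inverse_odd_tendsto_0[of "2 * M"]]) simp
  then show ?thesis by (rule LIM_zero_cancel)
qed

lemma int_shift_invariant:
  fixes f :: "int \<Rightarrow> 'a"
  assumes "\<And>n. f (n + 1) = f n"
  shows "f n = f 0"
  using assms assms[of "n - 1" for n] by (induction n rule: int_induct[of _ 0]) simp_all

text \<open>All windows of one period length \<open>q\<close> contain the same number
  \<open>c\<close> of stripes. Along the radii \<open>j * q\<close> the mean tends to
  \<open>c / q\<close>, and this subsequence has the limit \<open>x\<close>.\<close>

lemma periodic_mean_rational:
  fixes s :: "int \<Rightarrow> bool"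
  assumes "\<And>n. s (n + p) = s n" "p \<noteq> 0" and lim: "stripe_mean s \<longlonglongrightarrow> x"
  shows "x \<in> \<rat>"
proof -
  define q where "q = nat \<bar>p\<bar>"
  have "q > 0" using assms(2) by (simp add: q_def)
  have "s (n + int q) = s n" for n
    using assms(1)[of n] assms(1)[of "n - p"] by (cases "p > 0") (auto simp: q_def)
  then have per: "s (n + int q) = s n" for n .
  define c where "c = (\<Sum>n\<in>{0..<int q}. of_bool (s n) :: real)"
  define g where "g n = (\<Sum>i\<in>{n..<n + int q}. of_bool (s i) :: real)" for n
  have win: "g n = c" for n
  proof -
    have 1: "g (n + 1) = g n" for n
    proof -
      have "{n..<n + int q} = insert n {n + 1..<n + int q}"
        "{n + 1..<n + 1 + int q} = insert (n + int q) {n + 1..<n + int q}"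
        using \<open>q > 0\<close> by auto
      then show ?thesis unfolding g_def by (simp add: per del: sum_of_bool_eq)
    qed
    have "g n = g 0" using 1 by (rule int_shift_invariant)
    then show ?thesis by (simp add: g_def c_def)
  qed
  \<comment> \<open>The window of radius \<open>j * q\<close> has odd length: it consists of site 0
    and \<open>2 * j\<close> full periods, and each induction step adds one period at either
    end.\<close>
  have sum: "(\<Sum>n\<in>{-int (j * q)..int (j * q)}. of_bool (s n)) = 2 * real j * c + of_bool (s 0)" for j
  proof (induction j)
    case (Suc j)
    define N where "N = int (j * q)"
    have "N \<ge> 0" unfolding N_def by (rule of_nat_0_le_iff)
    have "int (Suc j * q) = N + int q" by (simp add: N_def)
    then have "{-int (Suc j * q)..int (Suc j * q)} = {- (N + int q)..N + int q}" by (simp only:)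
    also have "\<dots> = {- (N + int q)..<- (N + int q) + int q} \<union> {-N..N} \<union> {N + 1..<N + 1 + int q}"
      using \<open>N \<ge> 0\<close> by auto
    also have "(\<Sum>n\<in>\<dots>. of_bool (s n)) = g (- (N + int q)) + (\<Sum>n\<in>{-N..N}. of_bool (s n)) + g (N + 1)"
      unfolding g_def using \<open>N \<ge> 0\<close>
      by (simp add: sum.union_disjoint ivl_disj_int disjoint_iff del: sum_of_bool_eq)
    finally show ?case
      unfolding Suc[folded N_def] win by (simp add: algebra_simps del: sum_of_bool_eq)
  qed simp
  have "(\<lambda>j. stripe_mean s (j * q) - c / q) \<longlonglongrightarrow> 0"
  proof (rule Lim_null_comparison)
    have "stripe_mean s (j * q) - c / q = (of_bool (s 0) - c / q) / (2 * real (j * q) + 1)" for j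
    proof -
      have "2 * real j * c = (2 * real (j * q)) * (c / q)" using \<open>q > 0\<close> by simp
      then have "stripe_mean s (j * q)
          = ((2 * real (j * q) + 1) * (c / q) + (of_bool (s 0) - c / q)) / (2 * real (j * q) + 1)"
        unfolding stripe_mean_def sum by (simp add: algebra_simps)
      also have "\<dots> = c / q + (of_bool (s 0) - c / q) / (2 * real (j * q) + 1)"
      proof -
        have "(L * a + b) / L = a + b / L" if "L \<noteq> 0" for L a b :: real
          using that by (simp add: add_divide_distrib)
        moreover have "2 * real (j * q) + 1 \<noteq> 0" by (smt (verit) of_nat_0_le_iff)
        ultimately show ?thesis by blast
      qed
      finally show ?thesis by simp
    qed
    moreover have "\<bar>of_bool (s 0) - c / q\<bar> / (2 * real (j * q) + 1)
       \<le> \<bar>of_bool (s 0) - c / q\<bar> / (2 * real j + 1)" for j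
    proof (rule frac_le)
      have "real j \<le> real (j * q)" using \<open>q > 0\<close> by (simp only: of_nat_le_iff) simp
      then show "2 * real j + 1 \<le> 2 * real (j * q) + 1" by linarith
    qed auto
    ultimately show "\<forall>\<^sub>F j in sequentially. norm (stripe_mean s (j * q) - c / q)
        \<le> \<bar>of_bool (s 0) - c / q\<bar> / (2 * real j + 1)"
      by simp
    show "(\<lambda>j. \<bar>of_bool (s 0) - c / q\<bar> / (2 * real j + 1)) \<longlonglongrightarrow> 0"
      by (rule inverse_odd_tendsto_0)
  qed
  then have "(\<lambda>j. stripe_mean s (j * q)) \<longlonglongrightarrow> c / q" by (rule LIM_zero_cancel)
  moreover have "(\<lambda>j. stripe_mean s (j * q)) \<longlonglongrightarrow> x"
    using LIMSEQ_subseq_LIMSEQ[OF lim, of "\<lambda>j. j * q"] \<open>q > 0\<close>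
    by (simp add: comp_def strict_mono_def)
  ultimately have "x = c / q" using LIMSEQ_unique by blast
  moreover have "c \<in> \<rat>" unfolding c_def by simp
  ultimately show ?thesis by simp
qed

section \<open>Bilinear forms and the discrete divergence theorem\<close>

text \<open>Generic over the ring, since the same form is evaluated on stripe bits as integers and
  on frequencies as reals.\<close>

definition bilinear_form :: "'a::comm_ring_1 \<Rightarrow> 'a \<Rightarrow> 'a \<Rightarrow> 'a \<Rightarrow> 'a \<Rightarrow> 'a \<Rightarrow> 'a" where
  "bilinear_form c0 c1 c2 c3 x y = c0 + c1 * x + c2 * y + c3 * x * y"

text \<open>Since \<open>s\<close> depends on the column and \<open>t\<close> on the row only, the
  form summed over a box of side \<open>L\<close> is \<open>L * L\<close> times its value at the two
  means. The divergence telescopes to \<open>4 * L\<close> boundary terms of modulus at most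
  \<open>M\<close>, so that value is at most \<open>4 * M / L\<close>.\<close>

lemma divergence_free_means:
  fixes c0 c1 c2 c3 M :: int and v h :: "int \<Rightarrow> int \<Rightarrow> int"
  assumes div: "\<And>n m. v (n + 1) m - v n m + (h n (m + 1) - h n m)
      = bilinear_form c0 c1 c2 c3 (of_bool (s n)) (of_bool (t m))"
    and v: "\<And>n m. \<bar>v n m\<bar> \<le> M" and h: "\<And>n m. \<bar>h n m\<bar> \<le> M"
  shows "(\<lambda>K. bilinear_form (of_int c0) (of_int c1) (of_int c2) (of_int c3)
            (stripe_mean s K) (stripe_mean t K)) \<longlonglongrightarrow> 0"
proof (rule Lim_null_comparison)
  have "norm (bilinear_form (of_int c0) (of_int c1) (of_int c2) (of_int c3)
            (stripe_mean s K) (stripe_mean t K)) \<le> 4 * of_int M / (2 * real K + 1)" for K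
  proof -
    define X where "X = {-int K..int K}"
    define L where "L = 2 * real K + 1"
    have L: "L > 0" "real (card X) = L" "real_of_int (int (card X)) = L" by (auto simp: L_def X_def)
    have cs: "(\<Sum>n\<in>X. of_bool (s n)) = L * stripe_mean s K" "(\<Sum>n\<in>X. of_bool (t n)) = L * stripe_mean t K"
      using L by (auto simp: stripe_mean_def L_def X_def)
    define Z where "Z = (\<Sum>n\<in>X. \<Sum>m\<in>X. bilinear_form c0 c1 c2 c3 (of_bool (s n)) (of_bool (t m)))"
    have "real_of_int Z = (\<Sum>n\<in>X. \<Sum>m\<in>X. bilinear_form (of_int c0) (of_int c1) (of_int c2) (of_int c3)
        (of_bool (s n)) (of_bool (t m)))"
      unfolding Z_def bilinear_form_def by simp
    also have "\<dots> = L * L * bilinear_form (of_int c0) (of_int c1) (of_int c2) (of_int c3)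
            (stripe_mean s K) (stripe_mean t K)"
      unfolding bilinear_form_def
      by (simp add: sum.distrib L cs algebra_simps flip: sum_distrib_left sum_distrib_right)
    finally have Z1: "real_of_int Z = \<dots>" .
    \<comment> \<open>Swapping the order of summation for \<open>v\<close> lets each double sum
      telescope in its inner variable.\<close>
    have "Z = (\<Sum>m\<in>X. \<Sum>n\<in>X. v (n + 1) m - v n m) + (\<Sum>n\<in>X. \<Sum>m\<in>X. h n (m + 1) - h n m)"
      unfolding Z_def div[symmetric] sum.distrib
      by (subst sum.swap[of "\<lambda>m n. v (n + 1) m - v n m"]) simp
    also have "\<dots> = (\<Sum>m\<in>X. v (int K + 1) m - v (- int K) m) + (\<Sum>n\<in>X. h n (int K + 1) - h n (- int K))"
    proof -
      have "(\<Sum>n\<in>X. v (n + 1) m - v n m) = v (int K + 1) m - v (- int K) m" for m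
        unfolding X_def by (rule sum_telescope_symmetric_interval)
      moreover have "(\<Sum>m\<in>X. h n (m + 1) - h n m) = h n (int K + 1) - h n (- int K)" for n
        unfolding X_def by (rule sum_telescope_symmetric_interval)
      ultimately show ?thesis by presburger
    qed
    finally have "\<bar>Z\<bar> \<le> (\<Sum>m\<in>X. \<bar>v (int K + 1) m - v (- int K) m\<bar>)
       + (\<Sum>n\<in>X. \<bar>h n (int K + 1) - h n (- int K)\<bar>)"
      by (simp only:) (intro order_trans[OF abs_triangle_ineq] add_mono sum_abs)
    also have "\<dots> \<le> (\<Sum>m\<in>X. M + M) + (\<Sum>m\<in>X. M + M)"
      by (intro add_mono sum_mono order_trans[OF abs_triangle_ineq4] v h)
    also have "\<dots> = 4 * M * int (card X)" by simp
    finally have "real_of_int \<bar>Z\<bar> \<le> real_of_int (4 * M * int (card X))" by (simp only: of_int_le_iff)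
    then have "\<bar>real_of_int Z\<bar> \<le> 4 * of_int M * L" using L by simp
    then have "L * (L * \<bar>bilinear_form (of_int c0) (of_int c1) (of_int c2) (of_int c3)
            (stripe_mean s K) (stripe_mean t K)\<bar>) \<le> L * (4 * of_int M)"
      using L(1) unfolding Z1 by (simp add: abs_mult algebra_simps)
    then have "L * \<bar>bilinear_form (of_int c0) (of_int c1) (of_int c2) (of_int c3)
            (stripe_mean s K) (stripe_mean t K)\<bar> \<le> 4 * of_int M"
      using L(1) by (simp only: mult_le_cancel_left_pos)
    then show ?thesis using L(1) unfolding L_def[symmetric] by (simp add: pos_le_divide_eq mult.commute)
  qed
  then show "\<forall>\<^sub>F K in sequentially. norm (bilinear_form (of_int c0) (of_int c1) (of_int c2) (of_int c3)
            (stripe_mean s K) (stripe_mean t K)) \<le> 4 * of_int M / (2 * real K + 1)" by simp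
qed (rule inverse_odd_tendsto_0)

section \<open>Colors, tile set and quadrilateral\<close>

text \<open>The stripe bit and the two coordinates of an integer vector are packed into a natural
  number, the type of colors in the theorem.\<close>

definition colour :: "bool \<Rightarrow> int \<Rightarrow> int \<Rightarrow> nat" where
  "colour e p q = to_nat (e, p, q)"

definition striped :: "nat \<Rightarrow> bool" where
  "striped i = fst (from_nat i :: bool \<times> int \<times> int)"

definition weight1 :: "nat \<Rightarrow> int" where
  "weight1 i = fst (snd (from_nat i :: bool \<times> int \<times> int))"

definition weight2 :: "nat \<Rightarrow> int" where
  "weight2 i = snd (snd (from_nat i :: bool \<times> int \<times> int))"

lemma colour_simps [simp]:
  "striped (colour e p q) = e" "weight1 (colour e p q) = p" "weight2 (colour e p q) = q"
  by (simp_all add: colour_def striped_def weight1_def weight2_def)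

definition colours :: "int \<Rightarrow> nat set" where
  "colours M = (\<lambda>(e, p, q). colour e p q) ` (UNIV \<times> {-M..M} \<times> {-M..M})"

lemma finite_colours: "finite (colours M)"
  by (simp add: colours_def)

lemma colour_in_colours: "\<bar>p\<bar> \<le> M \<Longrightarrow> \<bar>q\<bar> \<le> M \<Longrightarrow> colour e p q \<in> colours M"
  by (force simp: colours_def)

lemma weight_bounds: "i \<in> colours M \<Longrightarrow> \<bar>weight1 i\<bar> \<le> M" "i \<in> colours M \<Longrightarrow> \<bar>weight2 i\<bar> \<le> M"
  by (auto simp: colours_def)

definition colour_class :: "int \<Rightarrow> bool \<Rightarrow> nat set" where
  "colour_class M e = {i \<in> colours M. striped i = e}"

text \<open>The first argument of \<open>f\<close> and \<open>g\<close> tells whether a vertical stripe is present, the second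
  one whether a horizontal stripe is.\<close>

definition divergence_tiles ::
  "int \<Rightarrow> (bool \<Rightarrow> bool \<Rightarrow> int) \<Rightarrow> (bool \<Rightarrow> bool \<Rightarrow> int) \<Rightarrow> (nat, nat) tile set" where
  "divergence_tiles M f g = {(a, b, c, d). {a, b, c, d} \<subseteq> colours M \<and>
     striped a = striped c \<and> striped b = striped d \<and>
     weight1 a + weight1 b - weight1 c - weight1 d = f (striped b) (striped a) \<and>
     weight2 a + weight2 b - weight2 c - weight2 d = g (striped b) (striped a)}"

lemma wang_tile_set_divergence_tiles:
  "wang_tile_set (colours M) (colours M) (divergence_tiles M f g)"
  by (auto simp: wang_tile_set_def finite_colours divergence_tiles_def)

lemma has_stripes_divergence_tiles:
  "has_stripes (colours M) (colours M) (colour_class M False) (colour_class M True)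
     (colour_class M False) (colour_class M True) (divergence_tiles M f g)"
  by (auto simp: has_stripes_def partition2_def colour_class_def divergence_tiles_def)

lemma divergence_tiles_eq_Un_tile_part:
  fixes M f g
  defines "T \<equiv> divergence_tiles M f g"
    and "X0 \<equiv> colour_class M False" and "X1 \<equiv> colour_class M True"
  shows "T = tile_part T X0 X0 \<union> tile_part T X0 X1 \<union> tile_part T X1 X0 \<union> tile_part T X1 X1"
  by (auto simp: assms tile_part_def colour_class_def divergence_tiles_def)

text \<open>The weight vector of a color serves as both \<open>v\<close> and \<open>h\<close>. The
  corner \<open>B\<close> belongs to tiles with a horizontal stripe only, hence to the arguments
  \<open>False True\<close>.\<close>

lemma determines_quadrilateral_divergence_tiles:
  "determines_quadrilateral (colour_class M False) (colour_class M True)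
     (colour_class M False) (colour_class M True) (divergence_tiles M f g)
     (of_int (f False False), of_int (g False False)) (of_int (f False True), of_int (g False True))
     (of_int (f True False), of_int (g True False)) (of_int (f True True), of_int (g True True))"
proof -
  define v :: "nat \<Rightarrow> real \<times> real" where "v i = (of_int (weight1 i), of_int (weight2 i))" for i
  have "v a + v b - v c - v d = (of_int (f (striped b) (striped a)), of_int (g (striped b) (striped a)))"
    if "(a, b, c, d) \<in> divergence_tiles M f g" for a b c d
  proof -
    have "f (striped b) (striped a) = weight1 a + weight1 b - weight1 c - weight1 d"
      "g (striped b) (striped a) = weight2 a + weight2 b - weight2 c - weight2 d"
      using that by (simp_all add: divergence_tiles_def)
    then show ?thesis by (simp add: v_def)
  qed
  then show ?thesis unfolding determines_quadrilateral_def
    by (intro exI[of _ v]) (auto simp: tile_part_def colour_class_def)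
qed

section \<open>Stripes of a valid tiling\<close>

text \<open>Vertical stripes cross horizontal edges, so the bit of a column is read from a south
  edge. Row 0 stands for all rows by \<open>striped_south\<close>.\<close>

definition vertical_stripes :: "(int \<times> int \<Rightarrow> (nat, nat) tile) \<Rightarrow> int \<Rightarrow> bool" where
  "vertical_stripes w n = striped (south (w (n, 0)))"

definition horizontal_stripes :: "(int \<times> int \<Rightarrow> (nat, nat) tile) \<Rightarrow> int \<Rightarrow> bool" where
  "horizontal_stripes w m = striped (west (w (0, m)))"

lemma divergence_tilesD:
  assumes "\<tau> \<in> divergence_tiles M f g"
  shows "west \<tau> \<in> colours M" "south \<tau> \<in> colours M" "east \<tau> \<in> colours M" "north \<tau> \<in> colours M"
    "striped (east \<tau>) = striped (west \<tau>)" "striped (north \<tau>) = striped (south \<tau>)"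
    "weight1 (east \<tau>) + weight1 (north \<tau>) - weight1 (west \<tau>) - weight1 (south \<tau>)
       = f (striped (south \<tau>)) (striped (west \<tau>))"
    "weight2 (east \<tau>) + weight2 (north \<tau>) - weight2 (west \<tau>) - weight2 (south \<tau>)
       = g (striped (south \<tau>)) (striped (west \<tau>))"
  using assms by (auto simp: divergence_tiles_def)

lemma stripe_tiles_iff:
  assumes "\<tau> \<in> divergence_tiles M f g"
  shows "\<tau> \<in> vertical_stripe_tiles (colour_class M False) (colour_class M True)
      (colour_class M False) (colour_class M True) (divergence_tiles M f g) \<longleftrightarrow> striped (south \<tau>)"
    and "\<tau> \<in> horizontal_stripe_tiles (colour_class M False) (colour_class M True)
      (colour_class M False) (colour_class M True) (divergence_tiles M f g) \<longleftrightarrow> striped (west \<tau>)"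
  using assms
  by (auto simp: vertical_stripe_tiles_def horizontal_stripe_tiles_def tile_part_def
      colour_class_def divergence_tiles_def)

lemma box_strip_density:
  "real (card ({n \<in> {-int K..int K}. s n} \<times> {-int K..int K})) / (2 * real K + 1)\<^sup>2 = stripe_mean s K"
  "real (card ({-int K..int K} \<times> {n \<in> {-int K..int K}. s n})) / (2 * real K + 1)\<^sup>2 = stripe_mean s K"
proof -
  have "real (card {-int K..int K}) = 2 * real K + 1" by simp
  moreover have "(\<Sum>n\<in>{-int K..int K}. of_bool (s n)) = real (card {n \<in> {-int K..int K}. s n})"
    by (simp add: Int_def)
  moreover have "c * L / L\<^sup>2 = c / L" "L * c / L\<^sup>2 = c / L" for c L :: real
    by (simp_all add: power2_eq_square)
  ultimately show
    "real (card ({n \<in> {-int K..int K}. s n} \<times> {-int K..int K})) / (2 * real K + 1)\<^sup>2 = stripe_mean s K"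
    "real (card ({-int K..int K} \<times> {n \<in> {-int K..int K}. s n})) / (2 * real K + 1)\<^sup>2 = stripe_mean s K"
    unfolding stripe_mean_def card_cartesian_product of_nat_mult by presburger+
qed

context
  fixes M f g w
  assumes w: "valid_tiling (divergence_tiles M f g) w"
begin

lemma tile_in: "w i \<in> divergence_tiles M f g"
  and east_eq: "east (w (n, m)) = west (w (n + 1, m))"
  and north_eq: "north (w (n, m)) = south (w (n, m + 1))"
  using w by (cases i, auto simp: valid_tiling_def)

text \<open>A tile has equal bits at its south and north edges, and the north edge is the south edge
  of the tile above, so the bit spreads along the column.\<close>

lemma striped_south: "striped (south (w (n, m))) = vertical_stripes w n"
proof -
  have "striped (south (w (n, m + 1))) = striped (south (w (n, m)))" for m
    using divergence_tilesD(6)[OF tile_in] by (metis north_eq)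
  then show ?thesis
    unfolding vertical_stripes_def by (rule int_shift_invariant)
qed

lemma striped_west: "striped (west (w (n, m))) = horizontal_stripes w m"
proof -
  have "striped (west (w (n + 1, m))) = striped (west (w (n, m)))" for n
    using divergence_tilesD(5)[OF tile_in] by (metis east_eq)
  then show ?thesis
    unfolding horizontal_stripes_def by (rule int_shift_invariant)
qed

lemma vertical_stripes_density:
  "has_density w (vertical_stripe_tiles (colour_class M False) (colour_class M True)
      (colour_class M False) (colour_class M True) (divergence_tiles M f g)) x
   \<longleftrightarrow> stripe_mean (vertical_stripes w) \<longlonglongrightarrow> x"
proof -
  have "{n \<in> {- int K..int K} \<times> {- int K..int K}. w n \<in> vertical_stripe_tiles
      (colour_class M False) (colour_class M True) (colour_class M False) (colour_class M True)
      (divergence_tiles M f g)}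
    = {n \<in> {- int K..int K}. vertical_stripes w n} \<times> {- int K..int K}" for K
    by (auto simp: stripe_tiles_iff[OF tile_in] striped_south)
  then show ?thesis
    unfolding has_density_def by (simp only: box_strip_density)
qed

lemma horizontal_stripes_density:
  "has_density w (horizontal_stripe_tiles (colour_class M False) (colour_class M True)
      (colour_class M False) (colour_class M True) (divergence_tiles M f g)) x
   \<longleftrightarrow> stripe_mean (horizontal_stripes w) \<longlonglongrightarrow> x"
proof -
  have "{n \<in> {- int K..int K} \<times> {- int K..int K}. w n \<in> horizontal_stripe_tiles
      (colour_class M False) (colour_class M True) (colour_class M False) (colour_class M True)
      (divergence_tiles M f g)}
    = {- int K..int K} \<times> {n \<in> {- int K..int K}. horizontal_stripes w n}" for K
    by (auto simp: stripe_tiles_iff[OF tile_in] striped_west)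
  then show ?thesis
    unfolding has_density_def by (simp only: box_strip_density)
qed

text \<open>By edge matching, the east weight is the west weight one step to the right and the north
  weight is the south weight one step up. The tile condition is thus the divergence equation for the
  west and south weights, one equation per coordinate.\<close>

lemma tiling_mean_equations:
  shows "(\<And>x y. f x y = bilinear_form c0 c1 c2 c3 (of_bool x) (of_bool y)) \<Longrightarrow>
      (\<lambda>K. bilinear_form (of_int c0) (of_int c1) (of_int c2) (of_int c3)
         (stripe_mean (vertical_stripes w) K) (stripe_mean (horizontal_stripes w) K)) \<longlonglongrightarrow> 0"
    and "(\<And>x y. g x y = bilinear_form c0 c1 c2 c3 (of_bool x) (of_bool y)) \<Longrightarrow>
      (\<lambda>K. bilinear_form (of_int c0) (of_int c1) (of_int c2) (of_int c3)
         (stripe_mean (vertical_stripes w) K) (stripe_mean (horizontal_stripes w) K)) \<longlonglongrightarrow> 0"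
proof -
  have col: "\<bar>weight1 (west (w n))\<bar> \<le> M" "\<bar>weight1 (south (w n))\<bar> \<le> M"
    "\<bar>weight2 (west (w n))\<bar> \<le> M" "\<bar>weight2 (south (w n))\<bar> \<le> M" for n
    using divergence_tilesD(1,2)[OF tile_in] weight_bounds by blast+
  show "(\<lambda>K. bilinear_form (of_int c0) (of_int c1) (of_int c2) (of_int c3)
         (stripe_mean (vertical_stripes w) K) (stripe_mean (horizontal_stripes w) K)) \<longlonglongrightarrow> 0"
    if "\<And>x y. f x y = bilinear_form c0 c1 c2 c3 (of_bool x) (of_bool y)"
    using divergence_tilesD(7)[OF tile_in] col
    by (intro divergence_free_means[where v = "\<lambda>n m. weight1 (west (w (n, m)))"
          and h = "\<lambda>n m. weight1 (south (w (n, m)))" and M = M])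
       (simp_all add: striped_south striped_west algebra_simps flip: that east_eq north_eq)
  show "(\<lambda>K. bilinear_form (of_int c0) (of_int c1) (of_int c2) (of_int c3)
         (stripe_mean (vertical_stripes w) K) (stripe_mean (horizontal_stripes w) K)) \<longlonglongrightarrow> 0"
    if "\<And>x y. g x y = bilinear_form c0 c1 c2 c3 (of_bool x) (of_bool y)"
    using divergence_tilesD(8)[OF tile_in] col
    by (intro divergence_free_means[where v = "\<lambda>n m. weight2 (west (w (n, m)))"
          and h = "\<lambda>n m. weight2 (south (w (n, m)))" and M = M])
       (simp_all add: striped_south striped_west algebra_simps flip: that east_eq north_eq)
qed

text \<open>A shift by \<open>(p, q)\<close> also changes the row or column in which a bit is read,
  but the bit does not depend on that.\<close>

lemma periodic_stripes:
  assumes "\<And>n. w (n + (p, q)) = w n"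
  shows "vertical_stripes w (n + p) = vertical_stripes w n"
    and "horizontal_stripes w (n + q) = horizontal_stripes w n"
proof -
  show "vertical_stripes w (n + p) = vertical_stripes w n"
    using assms[of "(n, 0)"] striped_south[of "n + p" q] striped_south[of n 0] by simp
  show "horizontal_stripes w (n + q) = horizontal_stripes w n"
    using assms[of "(0, n)"] striped_west[of p "n + q"] striped_west[of 0 n] by simp
qed

end

section \<open>Tilings with Sturmian stripes\<close>

lemma valid_tiling_from_flows:
  assumes "\<And>n m. v1 (n + 1) m - v1 n m + (h1 n (m + 1) - h1 n m) = f (s n) (t m)"
    and "\<And>n m. v2 (n + 1) m - v2 n m + (h2 n (m + 1) - h2 n m) = g (s n) (t m)"
    and "\<And>n m. \<bar>v1 n m\<bar> \<le> M" "\<And>n m. \<bar>h1 n m\<bar> \<le> M" "\<And>n m. \<bar>v2 n m\<bar> \<le> M" "\<And>n m. \<bar>h2 n m\<bar> \<le> M"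
  obtains w where "valid_tiling (divergence_tiles M f g) w"
    "vertical_stripes w = s" "horizontal_stripes w = t"
proof -
  \<comment> \<open>West edges carry the row bit \<open>t m\<close>, since horizontal stripes run
    through them; south edges carry the column bit \<open>s n\<close>.\<close>
  define V where "V n m = colour (t m) (v1 n m) (v2 n m)" for n m
  define H where "H n m = colour (s n) (h1 n m) (h2 n m)" for n m
  define w where "w = (\<lambda>(n, m). (V (n + 1) m, H n (m + 1), V n m, H n m))"
  show ?thesis
  proof
    have "w (n, m) \<in> divergence_tiles M f g" for n m
      using assms(1,2)[of n m]
      by (simp add: w_def divergence_tiles_def V_def H_def colour_in_colours assms(3-6) algebra_simps)
    then show "valid_tiling (divergence_tiles M f g) w"
      by (auto simp: valid_tiling_def w_def)
  qed (simp_all add: fun_eq_iff vertical_stripes_def horizontal_stripes_def w_def V_def H_def)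
qed

text \<open>The mechanical word of slope \<alpha>: a stripe stands where the integer part of
  \<open>n * \<alpha>\<close> increases by one.\<close>

definition sturmian :: "real \<Rightarrow> int \<Rightarrow> bool" where
  "sturmian \<alpha> n \<longleftrightarrow> \<lfloor>of_int (n + 1) * \<alpha>\<rfloor> = \<lfloor>of_int n * \<alpha>\<rfloor> + 1"

lemma of_bool_sturmian:
  assumes "\<alpha> \<in> {0..1}"
  shows "of_bool (sturmian \<alpha> n) = \<lfloor>of_int (n + 1) * \<alpha>\<rfloor> - \<lfloor>of_int n * \<alpha>\<rfloor>"
proof -
  have "\<lfloor>of_int n * \<alpha>\<rfloor> \<le> \<lfloor>of_int n * \<alpha> + \<alpha>\<rfloor>" "\<lfloor>of_int n * \<alpha> + \<alpha>\<rfloor> \<le> \<lfloor>of_int n * \<alpha> + 1\<rfloor>"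
    using assms by (intro floor_mono; simp)+
  then show ?thesis by (auto simp: sturmian_def algebra_simps)
qed

lemma sturmian_mean:
  assumes "\<alpha> \<in> {0..1}"
  shows "stripe_mean (sturmian \<alpha>) \<longlonglongrightarrow> \<alpha>"
proof (rule bounded_coboundary_mean)
  have "of_bool (sturmian \<alpha> n) = real_of_int (of_bool (sturmian \<alpha> n))" for n by simp
  \<comment> \<open>Writing the floor as the number minus its fractional part exhibits the bit as
    \<alpha> plus a bounded coboundary.\<close>
  then show "of_bool (sturmian \<alpha> n) = \<alpha> + (- frac (of_int (n + 1) * \<alpha>) - - frac (of_int n * \<alpha>))" for n
    unfolding of_bool_sturmian[OF assms] by (simp add: frac_def algebra_simps)
  show "\<bar>- frac (of_int n * \<alpha>)\<bar> \<le> 1" for n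
    by (simp add: less_imp_le[OF frac_lt_1])
qed

text \<open>Replacing \<open>s n\<close> by \<alpha> changes the right-hand side by the horizontal
  difference of the bounded real flow \<open>- a n * (c1 + c3 * t m)\<close>. What remains depends
  on \<open>m\<close> alone, and its partial sums stay bounded because the form vanishes at
  (\<alpha>, \<beta>).\<close>

lemma sturmian_bilinear_flow:
  fixes c0 c1 c2 c3 :: int and \<alpha> \<beta> :: real
  assumes \<alpha>: "\<alpha> \<in> {0..1}" and \<beta>: "\<beta> \<in> {0..1}"
    and zero: "bilinear_form (of_int c0) (of_int c1) (of_int c2) (of_int c3) \<alpha> \<beta> = 0"
  obtains v h :: "int \<Rightarrow> int \<Rightarrow> int" and M where
    "\<And>n m. v (n + 1) m - v n m + (h n (m + 1) - h n m)
       = bilinear_form c0 c1 c2 c3 (of_bool (sturmian \<alpha> n)) (of_bool (sturmian \<beta> m))"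
    "\<And>n m. \<bar>v n m\<bar> \<le> M" "\<And>n m. \<bar>h n m\<bar> \<le> M"
proof -
  define s :: "int \<Rightarrow> int" where "s n = of_bool (sturmian \<alpha> n)" for n
  define t :: "int \<Rightarrow> int" where "t n = of_bool (sturmian \<beta> n)" for n
  define a where "a n = frac (of_int n * \<alpha>)" for n
  define e where "e m = \<lfloor>of_int m * \<beta>\<rfloor>" for m
  have t: "t m = e (m + 1) - e m" for m by (simp add: t_def e_def of_bool_sturmian[OF \<beta>])
  have s: "of_int (s n) = \<alpha> - (a (n + 1) - a n)" for n
    by (simp add: s_def a_def of_bool_sturmian[OF \<alpha>] frac_def algebra_simps del: of_int_of_bool)
  have a01: "0 \<le> a n" "a n < 1" for n by (simp_all add: a_def frac_lt_1)
  have t01: "t n = 0 \<or> t n = 1" for n by (simp add: t_def)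
  txt \<open>\<open>W n m\<close> sums the real flow through the first \<open>m\<close> edges of column \<open>n\<close>; rounding these
    partial sums instead of the flow itself keeps both components of the flow integral and bounded.\<close>
  define W where "W n m = - a n * (of_int c1 * of_int m + of_int c3 * of_int (e m))" for n m
  define v where "v n m = \<lfloor>W n (m + 1)\<rfloor> - \<lfloor>W n m\<rfloor>" for n m
  \<comment> \<open>The first two summands are the signed partial sum of the right-hand side in
    column \<open>n\<close> up to row \<open>m\<close>, as \<open>e\<close> sums \<open>t\<close>.
    Subtracting the net outflow given by the rounded \<open>W\<close> makes the divergence equation
    an identity.\<close>
  define h where "h n m = m * (c0 + c1 * s n) + e m * (c2 + c3 * s n) - (\<lfloor>W (n + 1) m\<rfloor> - \<lfloor>W n m\<rfloor>)" for n m
  \<comment> \<open>The 1 pays for rounding: a difference of two floors is less than 1 away from the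
    difference of the arguments.\<close>
  define M where "M = \<bar>c1\<bar> + \<bar>c2\<bar> + \<bar>c3\<bar> + 1"
  show ?thesis
  proof
    show "v (n + 1) m - v n m + (h n (m + 1) - h n m)
       = bilinear_form c0 c1 c2 c3 (of_bool (sturmian \<alpha> n)) (of_bool (sturmian \<beta> m))" for n m
      unfolding s_def[symmetric] t_def[symmetric] t v_def h_def bilinear_form_def
      by (simp add: algebra_simps)
    show "\<bar>v n m\<bar> \<le> M" for n m
    proof -
      have "W n (m + 1) - W n m = - a n * of_int (c1 + c3 * t m)"
        by (simp add: W_def t algebra_simps)
      then have "\<bar>W n (m + 1) - W n m\<bar> \<le> 1 * of_int \<bar>c1 + c3 * t m\<bar>"
        using a01[of n] by (simp only: abs_mult abs_minus_cancel of_int_abs) (intro mult_mono, auto)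
      moreover have "\<bar>c1 + c3 * t m\<bar> \<le> \<bar>c1\<bar> + \<bar>c3\<bar>" using t01[of m] by auto
      ultimately have "\<bar>W n (m + 1) - W n m\<bar> \<le> of_int (\<bar>c1\<bar> + \<bar>c3\<bar>)"
        by (smt (verit) of_int_le_iff)
      then show ?thesis unfolding v_def M_def by linarith
    qed
    show "\<bar>h n m\<bar> \<le> M" for n m
    proof -
      define b where "b = frac (of_int m * \<beta>)"
      have b: "of_int (e m) = of_int m * \<beta> - b" "0 \<le> b" "b < 1"
        by (simp_all add: b_def e_def frac_def frac_lt_1) (simp_all add: frac_lt_1 flip: frac_def)
      have "of_int (m * (c0 + c1 * s n) + e m * (c2 + c3 * s n)) - (W (n + 1) m - W n m)
        = of_int m * (of_int c0 + of_int c1 * \<alpha>) + of_int (e m) * (of_int c2 + of_int c3 * \<alpha>)"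
        by (simp add: W_def s algebra_simps)
      \<comment> \<open>The linear growth in \<open>m\<close> is isolated as a multiple of the form
        at (\<alpha>, \<beta>), which is zero; the rest is a fractional part times a
        constant.\<close>
      also have "\<dots> = of_int m * bilinear_form (of_int c0) (of_int c1) (of_int c2) (of_int c3) \<alpha> \<beta>
          - b * (of_int c2 + of_int c3 * \<alpha>)"
        unfolding bilinear_form_def b(1) by (simp add: algebra_simps)
      finally have "\<bar>of_int (m * (c0 + c1 * s n) + e m * (c2 + c3 * s n)) - (W (n + 1) m - W n m)\<bar>
         = b * \<bar>of_int c2 + of_int c3 * \<alpha>\<bar>"
        using b(2) by (simp add: zero abs_mult)
      also have "\<dots> \<le> 1 * (\<bar>of_int c2\<bar> + \<bar>of_int c3\<bar> * 1)"
        using b \<alpha> by (intro mult_mono order_trans[OF abs_triangle_ineq] add_left_mono)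
          (auto simp: abs_mult mult_left_le)
      finally have "\<bar>of_int (m * (c0 + c1 * s n) + e m * (c2 + c3 * s n)) - (W (n + 1) m - W n m)\<bar>
         \<le> of_int (\<bar>c2\<bar> + \<bar>c3\<bar>)" by simp
      then show ?thesis unfolding h_def M_def by linarith
    qed
  qed
qed

section \<open>Geometry of the corners and zeros of the bilinear map\<close>

lemma not_parallelI:
  fixes u v :: "real \<times> real"
  assumes "fst u * snd v \<noteq> snd u * fst v"
  shows "\<not> parallel u v"
proof -
  have "u \<noteq> v" using assms by auto
  have "v \<noteq> 0" using assms by auto
  moreover have "u \<notin> span {v}"
  proof
    assume "u \<in> span {v}"
    then obtain k where "u = k *\<^sub>R v" by (auto simp: span_singleton)
    then show False using assms by simp
  qed
  ultimately have "independent {u, v}" using \<open>u \<noteq> v\<close> by (simp add: independent_insert)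
  then have "dim (span {u, v}) = card {u, v}"
    unfolding dim_span by (rule dim_eq_card_independent)
  then show ?thesis using \<open>u \<noteq> v\<close> by (simp add: parallel_def)
qed

lemma not_collinearI:
  fixes A B C D :: "real \<times> real"
  assumes "fst (B - A) * snd (D - C) \<noteq> snd (B - A) * fst (D - C)"
  shows "\<not> collinear {A, B, C, D}"
proof
  assume "collinear {A, B, C, D}"
  then obtain u where "\<forall>x\<in>{A, B, C, D}. \<forall>y\<in>{A, B, C, D}. \<exists>c. x - y = c *\<^sub>R u"
    unfolding collinear_def by blast
  then obtain c d where "B - A = c *\<^sub>R u" "D - C = d *\<^sub>R u" by blast
  then show False using assms by simp
qed

lemma stripe_mean_bounds: "0 \<le> stripe_mean s K" "stripe_mean s K \<le> 1"
proof -
  have "(\<Sum>n\<in>{-int K..int K}. of_bool (s n) :: real) \<le> (\<Sum>n\<in>{-int K..int K}. 1)"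
    by (intro sum_mono) auto
  then show "stripe_mean s K \<le> 1" by (simp add: stripe_mean_def del: sum_of_bool_eq)
  show "0 \<le> stripe_mean s K" by (auto simp: stripe_mean_def intro!: divide_nonneg_nonneg)
qed

text \<open>A polynomial of degree at most one in each variable is the bilinear interpolation of its
  four corner values, and the right-hand side of \<open>stripe_equation\<close> is such an
  interpolation.\<close>

lemma stripe_equation_bilinear:
  fixes F G :: "real \<Rightarrow> real \<Rightarrow> real"
  assumes "F = bilinear_form c0 c1 c2 c3" "G = bilinear_form d0 d1 d2 d3"
  shows "stripe_equation (F 0 0, G 0 0) (F 0 1, G 0 1) (F 1 0, G 1 0) (F 1 1, G 1 1) x y
    \<longleftrightarrow> F x y = 0 \<and> G x y = 0"
proof -
  have "(1 - x) * ((1 - y) * H 0 0 + y * H 0 1) + x * ((1 - y) * H 1 0 + y * H 1 1) = H x y"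
    if "H = bilinear_form e0 e1 e2 e3" for H :: "real \<Rightarrow> real \<Rightarrow> real" and e0 e1 e2 e3
    unfolding that bilinear_form_def by (simp add: algebra_simps)
  note * = this[OF assms(1)] this[OF assms(2)]
  show ?thesis unfolding stripe_equation_def by (auto simp: *)
qed

text \<open>\<open>X\<close> times the first form plus the second one loses the product term and
  leaves a quadratic polynomial in \<open>X\<close>. So \<open>X\<close> converges by its vanishing
  steps, and \<open>Y\<close> follows from the first form, which is linear in
  \<open>Y\<close>.\<close>

lemma mean_pair_convergent:
  fixes X Y :: "nat \<Rightarrow> real"
  assumes F: "(\<lambda>K. bilinear_form R U (- k) 0 (X K) (Y K)) \<longlonglongrightarrow> 0"
    and G: "(\<lambda>K. bilinear_form (- Q) (- P) 0 k (X K) (Y K)) \<longlonglongrightarrow> 0"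
    and nz: "k \<noteq> 0" "U \<noteq> 0" and X: "\<And>K. \<bar>X K\<bar> \<le> 1"
    and step: "(\<lambda>K. X (Suc K) - X K) \<longlonglongrightarrow> 0"
  obtains x y where "X \<longlonglongrightarrow> x" "Y \<longlonglongrightarrow> y"
    "bilinear_form R U (- k) 0 x y = 0" "bilinear_form (- Q) (- P) 0 k x y = 0"
proof -
  let ?f = "\<lambda>K. bilinear_form R U (- k) 0 (X K) (Y K)"
  let ?g = "\<lambda>K. bilinear_form (- Q) (- P) 0 k (X K) (Y K)"
  \<comment> \<open>Boundedness of \<open>X\<close> keeps the product with a null sequence
    null.\<close>
  have "(\<lambda>K. X K * ?f K) \<longlonglongrightarrow> 0"
  proof (rule Lim_null_comparison)
    show "(\<lambda>K. \<bar>?f K\<bar>) \<longlonglongrightarrow> 0" using F by (rule tendsto_rabs_zero)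
    show "\<forall>\<^sub>F K in sequentially. norm (X K * ?f K) \<le> \<bar>?f K\<bar>"
      using X by (simp add: abs_mult mult_left_le_one_le)
  qed
  from tendsto_add[OF this G] have "(\<lambda>K. X K * ?f K + ?g K) \<longlonglongrightarrow> 0" by simp
  moreover have "X K * ?f K + ?g K = U * (X K)\<^sup>2 + (R - P) * X K + (- Q)" for K
    by (simp add: bilinear_form_def algebra_simps power2_eq_square)
  ultimately have "(\<lambda>K. U * (X K)\<^sup>2 + (R - P) * X K + (- Q)) \<longlonglongrightarrow> 0" by simp
  from quadratic_null_sequence_convergent[OF this nz(2) step]
  obtain x where x: "X \<longlonglongrightarrow> x" by (auto simp: convergent_def)
  \<comment> \<open>The 0 is the limit of the first form, left in place to match the limit
    rules.\<close>
  define y where "y = (R + U * x - 0) / k"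
  have "(\<lambda>K. (R + U * X K - ?f K) / k) \<longlonglongrightarrow> y"
    unfolding y_def using nz(1) by (intro tendsto_intros x F)
  moreover have "(R + U * X K - ?f K) / k = Y K" for K
    using nz(1) by (simp add: bilinear_form_def)
  ultimately have y: "Y \<longlonglongrightarrow> y" by simp
  have lim: "(\<lambda>K. bilinear_form c0 c1 c2 c3 (X K) (Y K)) \<longlonglongrightarrow> bilinear_form c0 c1 c2 c3 x y" for c0 c1 c2 c3
    unfolding bilinear_form_def by (intro tendsto_intros x y)
  show ?thesis
    using that[OF x y LIMSEQ_unique[OF lim F] LIMSEQ_unique[OF lim G]] .
qed

text \<open>\<alpha> and \<open>x\<close> are roots of one quadratic polynomial with integer
  coefficients, so either they coincide or their sum is rational. A rational \<open>y\<close> would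
  make \<open>x\<close> rational through the first equation.\<close>

lemma bilinear_zero_irrational:
  fixes R U k P Q :: int and \<alpha> \<beta> x y :: real
  assumes "U \<noteq> 0" "k \<noteq> 0" "\<alpha> \<notin> \<rat>"
    and "bilinear_form (of_int R) (of_int U) (- of_int k) 0 \<alpha> \<beta> = 0"
      "bilinear_form (- of_int Q) (- of_int P) 0 (of_int k) \<alpha> \<beta> = 0"
    and "bilinear_form (of_int R) (of_int U) (- of_int k) 0 x y = 0"
      "bilinear_form (- of_int Q) (- of_int P) 0 (of_int k) x y = 0"
  shows "x \<notin> \<rat>" "y \<notin> \<rat>"
proof -
  have quad: "of_int U * z\<^sup>2 + of_int (R - P) * z - of_int Q = (0 :: real)"
    if "bilinear_form (of_int R) (of_int U) (- of_int k) 0 z z' = 0"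
      "bilinear_form (- of_int Q) (- of_int P) 0 (of_int k) z z' = 0" for z z' :: real
  proof -
    have "of_int U * z\<^sup>2 + of_int (R - P) * z - of_int Q
       = z * bilinear_form (of_int R) (of_int U) (- of_int k) 0 z z'
         + bilinear_form (- of_int Q) (- of_int P) 0 (of_int k) z z'"
      by (simp add: bilinear_form_def algebra_simps power2_eq_square)
    then show ?thesis using that by simp
  qed
  show "x \<notin> \<rat>"
  proof
    assume x: "x \<in> \<rat>"
    have "(\<alpha> - x) * (of_int U * (\<alpha> + x) + of_int (R - P)) = 0"
      using quad[OF assms(4,5)] quad[OF assms(6,7)] by (simp add: algebra_simps power2_eq_square)
    moreover have "\<alpha> \<noteq> x" using assms(3) x by auto
    ultimately have "of_int U * (\<alpha> + x) + of_int (R - P) = 0" by simp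
    then have "\<alpha> = of_int (P - R) / of_int U - x" using assms(1) by (simp add: field_simps)
    also have "\<dots> \<in> \<rat>" using x by simp
    finally show False using assms(3) by simp
  qed
  show "y \<notin> \<rat>"
  proof
    assume y: "y \<in> \<rat>"
    have "x = (of_int k * y - of_int R) / of_int U"
      using assms(1,6) by (simp add: bilinear_form_def field_simps)
    also have "\<dots> \<in> \<rat>" using y by simp
    finally show False using \<open>x \<notin> \<rat>\<close> by simp
  qed
qed

section \<open>Assembly of the tile set, its corners and its tilings\<close>

theorem theorem2:
  fixes \<alpha> \<beta> :: real and K :: "complex set"
  assumes "quadratic_number_field K"
    and "complex_of_real \<alpha> \<in> K" and "complex_of_real \<beta> \<in> K"
    and "\<alpha> \<in> {0..1}" and "\<beta> \<in> {0..1}"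
    and "(\<alpha> \<notin> \<rat> \<and> \<beta> \<notin> \<rat>) \<or> (\<alpha> \<in> \<rat> \<and> \<beta> \<in> \<rat>)"
  shows "\<exists>(I::nat set) (J::nat set) I0 I1 J0 J1 (T::(nat, nat) tile set)
            (A::real \<times> real) (B::real \<times> real) (C::real \<times> real) (D::real \<times> real).
     wang_tile_set I J T \<and>
     has_stripes I J I0 I1 J0 J1 T \<and>
     T = tile_part T I0 J0 \<union> tile_part T I0 J1 \<union> tile_part T I1 J0 \<union> tile_part T I1 J1 \<and>
     A \<in> \<int> \<times> \<int> \<and> B \<in> \<int> \<times> \<int> \<and> C \<in> \<int> \<times> \<int> \<and> D \<in> \<int> \<times> \<int> \<and>
     \<not> collinear {A, B, C, D} \<and>
     stripe_equation A B C D \<alpha> \<beta> \<and>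
     determines_quadrilateral I0 I1 J0 J1 T A B C D \<and>
     \<not> parallel (B - A) (D - C) \<and> \<not> parallel (C - A) (D - B) \<and>
     (\<exists>w. valid_tiling T w \<and>
        has_density w (vertical_stripe_tiles I0 I1 J0 J1 T) \<alpha> \<and>
        has_density w (horizontal_stripe_tiles I0 I1 J0 J1 T) \<beta>) \<and>
     (\<forall>w. valid_tiling T w \<longrightarrow>
        (\<exists>x y. has_density w (vertical_stripe_tiles I0 I1 J0 J1 T) x \<and>
               has_density w (horizontal_stripe_tiles I0 I1 J0 J1 T) y \<and>
               stripe_equation A B C D x y)) \<and>
     (\<alpha> \<notin> \<rat> \<and> \<beta> \<notin> \<rat> \<longrightarrow> aperiodic_tile_set T)"
proof -
  obtain R U k P Q :: int where nz: "k \<noteq> 0" "U \<noteq> 0"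
    and rel: "of_int R + of_int U * \<alpha> - of_int k * \<beta> = 0"
      "of_int k * (\<alpha> * \<beta>) - of_int P * \<alpha> - of_int Q = 0"
    using quadratic_field_integer_relations[OF assms(1-3,6)] by metis
  \<comment> \<open>\<open>f\<close> and \<open>g\<close> are the components of \<Phi> on stripe
    bits, \<open>F\<close> and \<open>G\<close> the same components on real frequencies.\<close>
  define f where "f x y = bilinear_form R U (- k) 0 (of_bool x) (of_bool y)" for x y
  define g where "g x y = bilinear_form (- Q) (- P) 0 k (of_bool x) (of_bool y)" for x y
  define F :: "real \<Rightarrow> real \<Rightarrow> real" where "F = bilinear_form (of_int R) (of_int U) (- of_int k) 0"
  define G :: "real \<Rightarrow> real \<Rightarrow> real" where "G = bilinear_form (- of_int Q) (- of_int P) 0 (of_int k)"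
  have zero: "F \<alpha> \<beta> = 0" "G \<alpha> \<beta> = 0"
    using rel by (simp_all add: F_def G_def bilinear_form_def algebra_simps)
  obtain v1 h1 :: "int \<Rightarrow> int \<Rightarrow> int" and M1 where flow1:
    "\<And>n m. v1 (n + 1) m - v1 n m + (h1 n (m + 1) - h1 n m) = f (sturmian \<alpha> n) (sturmian \<beta> m)"
    "\<And>n m. \<bar>v1 n m\<bar> \<le> M1" "\<And>n m. \<bar>h1 n m\<bar> \<le> M1"
    using sturmian_bilinear_flow[OF assms(4,5), of R U "- k" 0] zero(1) unfolding F_def f_def by auto
  obtain v2 h2 :: "int \<Rightarrow> int \<Rightarrow> int" and M2 where flow2:
    "\<And>n m. v2 (n + 1) m - v2 n m + (h2 n (m + 1) - h2 n m) = g (sturmian \<alpha> n) (sturmian \<beta> m)"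
    "\<And>n m. \<bar>v2 n m\<bar> \<le> M2" "\<And>n m. \<bar>h2 n m\<bar> \<le> M2"
    using sturmian_bilinear_flow[OF assms(4,5), of "- Q" "- P" 0 k] zero(2) unfolding G_def g_def by auto
  define M where "M = max M1 M2"
  define T where "T = divergence_tiles M f g"
  define X0 where "X0 = colour_class M False"
  define X1 where "X1 = colour_class M True"
  note defs = T_def X0_def X1_def
  obtain w0 where w0: "valid_tiling T w0" "vertical_stripes w0 = sturmian \<alpha>"
    "horizontal_stripes w0 = sturmian \<beta>"
    unfolding T_def
    by (rule valid_tiling_from_flows[where ?v1.0 = v1 and ?h1.0 = h1 and ?v2.0 = v2 and ?h2.0 = h2
          and f = f and g = g and s = "sturmian \<alpha>" and t = "sturmian \<beta>" and M = M])
       (use flow1 flow2 in \<open>auto simp: M_def le_max_iff_disj\<close>)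
  define A B C D where "A = (F 0 0, G 0 0)" and "B = (F 0 1, G 0 1)"
    and "C = (F 1 0, G 1 0)" and "D = (F 1 1, G 1 1)"
  note corners = A_def B_def C_def D_def F_def G_def bilinear_form_def
  have eq: "stripe_equation A B C D x y \<longleftrightarrow> F x y = 0 \<and> G x y = 0" for x y
    unfolding A_def B_def C_def D_def by (rule stripe_equation_bilinear[OF F_def G_def])
  \<comment> \<open>The two determinants are \<open>- k * k\<close> and \<open>U * k\<close>, which
    is where both coefficients must be nonzero.\<close>
  have det: "fst (B - A) * snd (D - C) \<noteq> snd (B - A) * fst (D - C)"
    "fst (C - A) * snd (D - B) \<noteq> snd (C - A) * fst (D - B)"
    using nz by (simp_all add: corners algebra_simps)
  have tilings: "\<exists>x y. stripe_mean (vertical_stripes w) \<longlonglongrightarrow> x \<and>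
      stripe_mean (horizontal_stripes w) \<longlonglongrightarrow> y \<and> F x y = 0 \<and> G x y = 0"
    if w: "valid_tiling T w" for w
  proof -
    note means = tiling_mean_equations[OF w[unfolded T_def]]
    have "(\<lambda>K. F (stripe_mean (vertical_stripes w) K) (stripe_mean (horizontal_stripes w) K)) \<longlonglongrightarrow> 0"
      using means(1)[OF f_def] by (simp add: F_def)
    moreover have "(\<lambda>K. G (stripe_mean (vertical_stripes w) K) (stripe_mean (horizontal_stripes w) K)) \<longlonglongrightarrow> 0"
      using means(2)[OF g_def] by (simp add: G_def)
    ultimately show ?thesis
      unfolding F_def G_def
      by (rule mean_pair_convergent) (use nz stripe_mean_bounds in \<open>auto intro: stripe_mean_step\<close>)
  qed
  have aperiodic: "aperiodic_tile_set T" if irr: "\<alpha> \<notin> \<rat>"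
    unfolding aperiodic_tile_set_def
  proof (intro conjI allI impI)
    show "\<exists>w. valid_tiling T w" using w0(1) by blast
    fix w assume w: "valid_tiling T w"
    show "\<not> periodic_tiling w"
    proof
      assume "periodic_tiling w"
      then obtain p q where "(p, q) \<noteq> (0, 0)" and per: "\<And>n. w (n + (p, q)) = w n"
        unfolding periodic_tiling_def by (metis surj_pair)
      obtain x y where "stripe_mean (vertical_stripes w) \<longlonglongrightarrow> x"
        "stripe_mean (horizontal_stripes w) \<longlonglongrightarrow> y" and xy: "F x y = 0" "G x y = 0"
        using tilings[OF w] by blast
      \<comment> \<open>A nonzero period has a nonzero coordinate, and the stripes repeating along
        that coordinate have a rational frequency.\<close>
      then have "x \<in> \<rat> \<or> y \<in> \<rat>"
        using periodic_stripes[OF w[unfolded T_def] per] periodic_mean_rational \<open>(p, q) \<noteq> (0, 0)\<close>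
        by (metis Pair_inject)
      then show False
        using bilinear_zero_irrational[OF nz(2,1) irr, of R \<beta> Q P x y] zero xy by (auto simp: F_def G_def)
    qed
  qed
  show ?thesis
  proof (intro exI conjI)
    show "wang_tile_set (colours M) (colours M) T"
      unfolding T_def by (rule wang_tile_set_divergence_tiles)
    show "has_stripes (colours M) (colours M) X0 X1 X0 X1 T"
      unfolding defs by (rule has_stripes_divergence_tiles)
    show "T = tile_part T X0 X0 \<union> tile_part T X0 X1 \<union> tile_part T X1 X0 \<union> tile_part T X1 X1"
      unfolding defs by (rule divergence_tiles_eq_Un_tile_part)
    show "A \<in> \<int> \<times> \<int>" "B \<in> \<int> \<times> \<int>" "C \<in> \<int> \<times> \<int>" "D \<in> \<int> \<times> \<int>"
      by (simp_all add: corners)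
    show "\<not> collinear {A, B, C, D}" by (rule not_collinearI[OF det(1)])
    show "\<not> parallel (B - A) (D - C)" "\<not> parallel (C - A) (D - B)"
      by (rule not_parallelI[OF det(1)], rule not_parallelI[OF det(2)])
    show "stripe_equation A B C D \<alpha> \<beta>" using eq zero by simp
    have "A = (of_int (f False False), of_int (g False False))"
      "B = (of_int (f False True), of_int (g False True))"
      "C = (of_int (f True False), of_int (g True False))"
      "D = (of_int (f True True), of_int (g True True))"
      by (simp_all add: corners f_def g_def)
    then show "determines_quadrilateral X0 X1 X0 X1 T A B C D"
      unfolding defs by (simp only: determines_quadrilateral_divergence_tiles)
    show "valid_tiling T w0" by (rule w0(1))
    show "has_density w0 (vertical_stripe_tiles X0 X1 X0 X1 T) \<alpha>"
      "has_density w0 (horizontal_stripe_tiles X0 X1 X0 X1 T) \<beta>"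
      using w0 sturmian_mean[OF assms(4)] sturmian_mean[OF assms(5)]
      unfolding defs by (simp_all add: vertical_stripes_density horizontal_stripes_density)
    show "\<forall>w. valid_tiling T w \<longrightarrow>
        (\<exists>x y. has_density w (vertical_stripe_tiles X0 X1 X0 X1 T) x \<and>
               has_density w (horizontal_stripe_tiles X0 X1 X0 X1 T) y \<and>
               stripe_equation A B C D x y)"
      using tilings unfolding defs eq
      by (auto simp: vertical_stripes_density horizontal_stripes_density)
    show "\<alpha> \<notin> \<rat> \<and> \<beta> \<notin> \<rat> \<longrightarrow> aperiodic_tile_set T" using aperiodic by blast
  qed
qed

end
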